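(* Let $\mathcal{X}\in\mathbb{R}^{s_1\times\cdots\times s_N}$ be a tensor, let $A^{(l)}=A_p^{(l)}+dA^{(l)}\in\mathbb{R}^{s_l\times R}$, $l\in\{1,\ldots,N\}$, be the current CP factor matrices, where $A_p^{(l)}$ are the factor matrices at the time the pairwise perturbation operators were formed, and let $\delta A^{(n)}=A^{(n)}_{\mathrm{new}}-A^{(n)}$ be the change of the $n$-th factor matrix performed by a regular ALS sweep. Let $k\in\{1,\ldots,R\}$ and suppose that $$\frac{\|da_k^{(l)}\|_2}{\|a_k^{(l)}\|_2}\le \epsilon<1\quad\text{for all } l\in\{1,\ldots,N\}.$$ Then for all $m,n\in\{1,\ldots,N\}$ with $m\ne n$ (in particular for $(m,n)=(1,N)$), the pairwise perturbation algorithm without second order corrections computes the update $\tilde H^{(m,n)}$ (with $k$-th column $\tilde h_k^{(m,n)}$) with column-wise error $$\big\|\tilde h_k^{(m,n)}-h_k^{(m,n)}\big\|_2 = O(N\epsilon)\,\|\hat{\mathcal{T}}\|_2\prod_{j\in\{1,\ldots,N\}\setminus\{m,n\}}\|a_k^{(j)}\|_2,\qquad \hat{\mathcal{T}}=\mathcal{X}\times_n \delta a_k^{(n)T},$$ where $h_k^{(m,n)}$ is the $k$-th column of the exact ALS update $H^{(m,n)}$ to the MTTKRP matrix $M^{(m)}$ due to the change $\delta A^{(n)}$.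
   Context: Lower-case $a_k^{(l)}, da_k^{(l)},\delta a_k^{(l)}$ denote the $k$-th columns of $A^{(l)},dA^{(l)},\delta A^{(l)}$. For a vector $v\in\mathbb{R}^{s_n}$, $\mathcal{X}\times_n v^T$ is the contraction of $\mathcal{X}$ with $v$ along mode $n$ (mode $n$ is removed). Spectral norm of a tensor $\mathcal{T}$ of order $M$: $\|\mathcal{T}\|_2=\max \|\mathcal{T}\times_2 x^{(2)T}\cdots\times_M x^{(M)T}\|_2$ over unit vectors $x^{(2)},\ldots,x^{(M)}$ (this is invariant under reordering of modes). CP-ALS: a regular update of the $n$-th factor is $A^{(n)}_{\mathrm{new}}=M^{(n)}\Gamma^{(n)\dagger}$, where $M^{(n)}$ (the MTTKRP) has $k$-th column equal to the contraction of $\mathcal{X}$ with $a_k^{(j)}$ along every mode $j\neq n$, $\Gamma^{(n)}$ is the Hadamard product of $A^{(j)T}A^{(j)}$ over $j\ne n$, and $\dagger$ is the pseudoinverse. Let $\mathcal{M}^{(m,n)}(\cdot,\cdot,k)$ be the $s_m\times s_n$ matrix obtained by contracting $\mathcal{X}$ with $a_k^{(j)}$ along every mode $j\notin\{m,n\}$, and $\mathcal{M}_p^{(m,n)}(\cdot,\cdot,k)$ (the pairwise perturbation operator) the same with $a_k^{(j)}$ replaced by $a_{p,k}^{(j)}=a_k^{(j)}-da_k^{(j)}$, the $k$-th column of $A_p^{(j)}$. The exact ALS update is $h_k^{(m,n)}(x)=\sum_{y=1}^{s_n}\mathcal{M}^{(m,n)}(x,y,k)\,\delta A^{(n)}(y,k)$,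 and the update computed by pairwise perturbation without second order corrections is $\tilde h_k^{(m,n)}(x)=\sum_{y=1}^{s_n}\mathcal{M}_p^{(m,n)}(x,y,k)\,\delta A^{(n)}(y,k)$. The symbol $O(N\epsilon)$ is meant to leading order as $N\epsilon\to0$: there are absolute constants $C,c>0$ (independent of $N$, the dimensions, the tensor and the factors) such that whenever $N\epsilon\le c$ the left-hand side is at most $CN\epsilon$ times the remaining factors. *)

theory Defs
  imports Complex_Main "Jordan_Normal_Form.Matrix"
begin

text \<open>
  Modes, mode indices and rank-one components are all counted from 0.

  A real tensor with finite set of modes \<open>I\<close> and sizes \<open>s l\<close> (\<open>l \<in> I\<close>) is a function
  \<open>(nat \<Rightarrow> nat) \<Rightarrow> real\<close>; its entries are the values at the multi-indices
  \<open>i \<in> PiE I (\<lambda>l. {..<s l})\<close>, which are \<open>undefined\<close> outside \<open>I\<close>, and its other values are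
  irrelevant. Modes keep their names: contracting mode \<open>n\<close> of a tensor with modes \<open>I\<close> gives a
  tensor with modes \<open>I - {n}\<close>.
\<close>

type_synonym tensor = "(nat \<Rightarrow> nat) \<Rightarrow> real"

definition idx1 :: "nat \<Rightarrow> nat \<Rightarrow> nat \<Rightarrow> nat" where
  "idx1 m x = (\<lambda>_. undefined)(m := x)"

definition idx2 :: "nat \<Rightarrow> nat \<Rightarrow> nat \<Rightarrow> nat \<Rightarrow> nat \<Rightarrow> nat" where
  "idx2 m x n y = (\<lambda>_. undefined)(m := x, n := y)"

definition contract :: "(nat \<Rightarrow> nat) \<Rightarrow> nat \<Rightarrow> real vec \<Rightarrow> tensor \<Rightarrow> tensor" where
  "contract s n v X = (\<lambda>i. \<Sum>y<s n. X (i(n := y)) * v $ y)"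

text \<open>Contraction along every mode \<open>j \<in> J\<close> with \<open>v j\<close>. The order is immaterial, see
  \<open>contract_modes_insert\<close>.\<close>

definition contract_modes :: "(nat \<Rightarrow> nat) \<Rightarrow> (nat \<Rightarrow> real vec) \<Rightarrow> nat set \<Rightarrow> tensor \<Rightarrow> tensor" where
  "contract_modes s v J X = Finite_Set.fold (\<lambda>j. contract s j (v j)) X J"

lemma contract_commute:
  assumes "j \<noteq> k"
  shows "contract s j v (contract s k w X) = contract s k w (contract s j v X)"
proof
  fix i
  have "contract s j v (contract s k w X) i
      = (\<Sum>y<s j. \<Sum>z<s k. X (i(j := y, k := z)) * w $ z * v $ y)"
    by (simp add: contract_def sum_distrib_right)
  also have "\<dots> = (\<Sum>z<s k. \<Sum>y<s j. X (i(k := z, j := y)) * v $ y * w $ z)"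
    using assms by (subst sum.swap) (simp add: fun_upd_twist ac_simps)
  also have "\<dots> = contract s k w (contract s j v X) i"
    by (simp add: contract_def sum_distrib_right)
  finally show "contract s j v (contract s k w X) i = contract s k w (contract s j v X) i" .
qed

lemma contract_modes_empty [simp]: "contract_modes s v {} X = X"
  by (simp add: contract_modes_def)

lemma contract_modes_insert:
  assumes "finite J" "j \<notin> J"
  shows "contract_modes s v (insert j J) X = contract s j (v j) (contract_modes s v J X)"
proof -
  interpret comp_fun_commute "\<lambda>j. contract s j (v j)"
  proof
    fix x y :: nat
    show "contract s y (v y) \<circ> contract s x (v x) = contract s x (v x) \<circ> contract s y (v y)"
      by (cases "x = y") (auto simp: contract_commute)
  qed
  show ?thesis
    using assms by (simp add: contract_modes_def)
qed

definition vnorm :: "real vec \<Rightarrow> real" where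
  "vnorm v = sqrt (v \<bullet> v)"

text \<open>Spectral norm of a tensor with nonempty mode set \<open>I\<close>: the first mode \<open>Min I\<close> is left
  free, every other mode is contracted with a unit vector. The supremum is a maximum (continuous
  function on a product of spheres) when all \<open>s l > 0\<close>; for a single mode it is the Euclidean norm.\<close>

definition spectral_norm :: "nat set \<Rightarrow> (nat \<Rightarrow> nat) \<Rightarrow> tensor \<Rightarrow> real" where
  "spectral_norm I s T =
     (let p = Min I in
      Sup {vnorm (vec (s p) (\<lambda>z. contract_modes s x (I - {p}) T (idx1 p z))) | x.
             \<forall>l\<in>I - {p}. x l \<in> carrier_vec (s l) \<and> vnorm (x l) = 1})"

text \<open>Moore--Penrose pseudoinverse, by the four Penrose conditions (which determine \<open>P\<close>
  uniquely).\<close>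

definition is_pinv :: "real mat \<Rightarrow> real mat \<Rightarrow> bool" where
  "is_pinv G P \<longleftrightarrow> P \<in> carrier_mat (dim_col G) (dim_row G) \<and>
     G * P * G = G \<and> P * G * P = P \<and>
     transpose_mat (G * P) = G * P \<and> transpose_mat (P * G) = P * G"

definition pinv :: "real mat \<Rightarrow> real mat" where
  "pinv G = (THE P. is_pinv G P)"

text \<open>Below, \<open>N\<close> is the order of the tensor, its modes are \<open>{..<N}\<close>, \<open>R\<close> is the CP rank and
  \<open>A l\<close> is the factor matrix of mode \<open>l\<close>.\<close>

definition mttkrp ::
  "nat \<Rightarrow> (nat \<Rightarrow> nat) \<Rightarrow> nat \<Rightarrow> tensor \<Rightarrow> (nat \<Rightarrow> real mat) \<Rightarrow> nat \<Rightarrow> real mat" where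
  "mttkrp N s R X A n = mat (s n) R
     (\<lambda>(x, k). contract_modes s (\<lambda>j. col (A j) k) ({..<N} - {n}) X (idx1 n x))"

definition gram_hadamard :: "nat \<Rightarrow> nat \<Rightarrow> (nat \<Rightarrow> real mat) \<Rightarrow> nat \<Rightarrow> real mat" where
  "gram_hadamard N R A n = mat R R
     (\<lambda>(p, q). \<Prod>j\<in>{..<N} - {n}. (transpose_mat (A j) * A j) $$ (p, q))"

definition als_update ::
  "nat \<Rightarrow> (nat \<Rightarrow> nat) \<Rightarrow> nat \<Rightarrow> tensor \<Rightarrow> (nat \<Rightarrow> real mat) \<Rightarrow> nat \<Rightarrow> real mat" where
  "als_update N s R X A n = mttkrp N s R X A n * pinv (gram_hadamard N R A n)"

text \<open>The \<open>s m \<times> s n\<close> matrix \<open>\<M>\<^sup>(\<^sup>m\<^sup>,\<^sup>n\<^sup>)(\<cdot>, \<cdot>, k)\<close> for the factors \<open>A\<close>; applied to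
  the factors at which the pairwise perturbation was set up, it is the pairwise perturbation
  operator.\<close>

definition pair_op ::
  "nat \<Rightarrow> (nat \<Rightarrow> nat) \<Rightarrow> tensor \<Rightarrow> (nat \<Rightarrow> real mat) \<Rightarrow> nat \<Rightarrow> nat \<Rightarrow> nat \<Rightarrow> real mat" where
  "pair_op N s X A m n k = mat (s m) (s n)
     (\<lambda>(x, y). contract_modes s (\<lambda>j. col (A j) k) ({..<N} - {m, n}) X (idx2 m x n y))"

text \<open>Update of the MTTKRP matrix of mode \<open>m\<close> caused by the change \<open>D\<close> of the \<open>n\<close>-th factor.
  It is the exact ALS update for the current factors \<open>A\<close>, and the update of the pairwise
  perturbation algorithm without second order corrections for \<open>A\<close> replaced by \<open>A\<^sub>p\<close>.\<close>

definition mttkrp_update ::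
  "nat \<Rightarrow> (nat \<Rightarrow> nat) \<Rightarrow> nat \<Rightarrow> tensor \<Rightarrow> (nat \<Rightarrow> real mat) \<Rightarrow> nat \<Rightarrow> nat \<Rightarrow> real mat \<Rightarrow> real mat" where
  "mttkrp_update N s R X A m n D = mat (s m) R
     (\<lambda>(x, k). \<Sum>y<s n. pair_op N s X A m n k $$ (x, y) * D $$ (y, k))"

end

theory Submission
  imports Defs "HOL-Analysis.L2_Norm"
begin

text \<open>
  The update with the \<open>m\<close>-th mode free is multilinear in the columns \<open>a\<^sub>j\<close>, \<open>j \<notin> {m, n}\<close>, and its
  norm is at most \<open>\<parallel>T\<parallel> \<Prod> \<parallel>a\<^sub>j\<parallel>\<close>, where \<open>T\<close> is the tensor contracted with the change of the \<open>n\<close>-th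
  factor. Replacing the columns \<open>a\<^sub>j\<close> by the perturbed ones one at a time changes the update by at
  most \<open>((1 + \<epsilon>) ^ (N - 2) - 1) \<parallel>T\<parallel> \<Prod> \<parallel>a\<^sub>j\<parallel>\<close>, and \<open>(1 + \<epsilon>) ^ N - 1 \<le> exp (N \<epsilon>) - 1 \<le> 2 N \<epsilon>\<close>
  for \<open>N \<epsilon> \<le> 1\<close>.
\<close>

section \<open>Euclidean norm of vectors\<close>

lemma vnorm_L2_set: "vnorm v = L2_set (vec_index v) {..<dim_vec v}"
  by (simp add: vnorm_def L2_set_def scalar_prod_def power2_eq_square atLeast0LessThan)

lemma vnorm_vec: "vnorm (vec n f) = L2_set f {..<n}"
  unfolding vnorm_L2_set by (intro L2_set_cong) auto

lemma vnorm_smult: "vnorm (c \<cdot>\<^sub>v v) = \<bar>c\<bar> * vnorm v"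
proof -
  have "vnorm (c \<cdot>\<^sub>v v) = sqrt (c\<^sup>2 * (v \<bullet> v))"
    unfolding vnorm_def by (simp add: power2_eq_square mult.assoc)
  then show ?thesis
    by (simp add: vnorm_def real_sqrt_mult)
qed

lemma vnorm_nonneg: "0 \<le> vnorm v"
  by (simp add: vnorm_L2_set)

lemma vnorm_eq_0_iff: "vnorm v = 0 \<longleftrightarrow> (\<forall>y<dim_vec v. v $ y = 0)"
  unfolding vnorm_L2_set by (subst L2_set_eq_0_iff) auto

lemma abs_vec_index_le_vnorm:
  assumes "y < dim_vec v"
  shows "\<bar>v $ y\<bar> \<le> vnorm v"
proof -
  have "\<bar>v $ y\<bar> = L2_set (vec_index v) {y}"
    by (simp add: L2_set_def)
  also have "\<dots> \<le> vnorm v"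
    unfolding vnorm_L2_set L2_set_def using assms
    by (intro real_sqrt_le_mono sum_mono2) auto
  finally show ?thesis .
qed

lemma vnorm_triangle_diff:
  assumes "v \<in> carrier_vec n" "w \<in> carrier_vec n"
  shows "vnorm (v - w) \<le> vnorm v + vnorm w"
proof -
  have "vnorm (v - w) = L2_set (\<lambda>y. v $ y + - w $ y) {..<n}"
    using assms unfolding vnorm_L2_set by (intro L2_set_cong) auto
  also have "\<dots> \<le> L2_set (vec_index v) {..<n} + L2_set (\<lambda>y. - w $ y) {..<n}"
    by (rule L2_set_triangle_ineq)
  also have "\<dots> = vnorm v + vnorm w"
    using assms unfolding vnorm_L2_set by (simp add: L2_set_def)
  finally show ?thesis .
qed

section \<open>Multilinearity and monotonicity of contractions\<close>

lemma contract_contract_modes: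
  assumes "finite J" "n \<notin> J"
  shows "contract s n w (contract_modes s v J X) = contract_modes s v J (contract s n w X)"
  using assms
proof (induction J)
  case empty
  then show ?case by simp
next
  case (insert j J)
  then show ?case
    by (simp add: contract_modes_insert contract_commute[of n j])
qed

lemma contract_modes_cong:
  assumes "finite J" "\<And>j y. j \<in> J \<Longrightarrow> y < s j \<Longrightarrow> v j $ y = w j $ y"
  shows "contract_modes s v J X = contract_modes s w J X"
  using assms
proof (induction J)
  case empty
  then show ?case by simp
next
  case (insert j J)
  then show ?case
    by (simp add: contract_modes_insert contract_def)
qed

text \<open>The modes other than \<open>j\<close> do not see the update. The right-hand side is
  visibly linear in \<open>w\<close>, and in this form multilinearity in a single column is used
  later.\<close>

lemma contract_modes_upd:
  assumes "finite J" "j \<in> J"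
  shows "contract_modes s (v(j := w)) J X = contract s j w (contract_modes s v (J - {j}) X)"
proof -
  have "contract_modes s (v(j := w)) (insert j (J - {j})) X
      = contract s j w (contract_modes s (v(j := w)) (J - {j}) X)"
    using assms by (subst contract_modes_insert) auto
  also have "contract_modes s (v(j := w)) (J - {j}) X = contract_modes s v (J - {j}) X"
    using assms by (intro contract_modes_cong) auto
  finally show ?thesis
    using assms by (simp only: insert_Diff)
qed

text \<open>Serves to normalise the vectors to unit length; each contraction is linear in its
  vector, so the scalars come out one mode at a time.\<close>

lemma contract_modes_smult:
  assumes "finite J" "\<And>j. j \<in> J \<Longrightarrow> v j \<in> carrier_vec (s j)"
  shows "contract_modes s (\<lambda>j. c j \<cdot>\<^sub>v v j) J X i = (\<Prod>j\<in>J. c j) * contract_modes s v J X i"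
  using assms
proof (induction J arbitrary: i)
  case empty
  then show ?case by simp
next
  case (insert j J)
  have "v j \<in> carrier_vec (s j)"
    using insert.prems by simp
  then have "(c j \<cdot>\<^sub>v v j) $ y = c j * v j $ y" if "y < s j" for y
    using that by simp
  then show ?case
    using insert by (simp add: contract_modes_insert contract_def sum_distrib_left mult_ac)
qed

text \<open>The triangle inequality in each mode. With \<open>w\<close> all ones it gives a bound
  uniform over unit vectors, which makes the supremum in \<open>spectral_norm\<close>
  usable.\<close>

lemma abs_contract_modes_le:
  assumes "finite J" "\<And>j y. j \<in> J \<Longrightarrow> y < s j \<Longrightarrow> \<bar>v j $ y\<bar> \<le> w j $ y"
  shows "\<bar>contract_modes s v J X i\<bar> \<le> contract_modes s w J (\<lambda>i. \<bar>X i\<bar>) i"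
  using assms
proof (induction J arbitrary: i)
  case empty
  then show ?case by simp
next
  case (insert j J)
  let ?B = "contract_modes s w J (\<lambda>i. \<bar>X i\<bar>)"
  have "\<bar>contract_modes s v (insert j J) X i\<bar>
      \<le> (\<Sum>y<s j. \<bar>contract_modes s v J X (i(j := y)) * v j $ y\<bar>)"
    using insert.hyps by (simp add: contract_modes_insert contract_def)
  also have "\<dots> \<le> (\<Sum>y<s j. ?B (i(j := y)) * w j $ y)"
  proof (rule sum_mono)
    fix y assume "y \<in> {..<s j}"
    then have y: "\<bar>v j $ y\<bar> \<le> w j $ y"
      using insert.prems by simp
    have IH: "\<bar>contract_modes s v J X (i(j := y))\<bar> \<le> ?B (i(j := y))"
      using insert.prems by (intro insert.IH) auto
    show "\<bar>contract_modes s v J X (i(j := y)) * v j $ y\<bar> \<le> ?B (i(j := y)) * w j $ y"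
      unfolding abs_mult using y IH by (intro mult_mono) auto
  qed
  also have "\<dots> = contract_modes s w (insert j J) (\<lambda>i. \<bar>X i\<bar>) i"
    using insert.hyps by (simp add: contract_modes_insert contract_def)
  finally show ?case .
qed

section \<open>Fibres are bounded by the spectral norm, whichever mode is left free\<close>

abbreviation fibre_norm ::
  "(nat \<Rightarrow> nat) \<Rightarrow> (nat \<Rightarrow> real vec) \<Rightarrow> nat set \<Rightarrow> nat \<Rightarrow> tensor \<Rightarrow> real" where
  "fibre_norm s v I m T \<equiv> L2_set (\<lambda>z. contract_modes s v (I - {m}) T (idx1 m z)) {..<s m}"

text \<open>A member of a set of reals is known to lie below its \<open>Sup\<close> once the set is
  bounded above, so most of the work is a bound uniform in the unit vectors.\<close>

lemma fibre_norm_unit_le_spectral_norm: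
  assumes "finite I"
    and v: "\<And>j. j \<in> I - {Min I} \<Longrightarrow> v j \<in> carrier_vec (s j) \<and> vnorm (v j) = 1"
  shows "fibre_norm s v I (Min I) T \<le> spectral_norm I s T"
proof -
  define p where "p = Min I"
  let ?S = "{vnorm (vec (s p) (\<lambda>z. contract_modes s x (I - {p}) T (idx1 p z))) | x.
             \<forall>l\<in>I - {p}. x l \<in> carrier_vec (s l) \<and> vnorm (x l) = 1}"
  \<comment> \<open>Entries of a unit vector have absolute value at most 1, so contracting the
    absolute values of \<open>T\<close> with all-ones vectors dominates every candidate
    fibre.\<close>
  let ?B = "\<lambda>z. contract_modes s (\<lambda>j. vec (s j) (\<lambda>_. 1)) (I - {p}) (\<lambda>i. \<bar>T i\<bar>) (idx1 p z)"
  have "r \<le> L2_set ?B {..<s p}" if r: "r \<in> ?S" for r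
  proof -
    obtain x where r_eq: "r = L2_set (\<lambda>z. contract_modes s x (I - {p}) T (idx1 p z)) {..<s p}"
      and x: "\<forall>l\<in>I - {p}. x l \<in> carrier_vec (s l) \<and> vnorm (x l) = 1"
      using r unfolding vnorm_vec by blast
    have le: "\<bar>contract_modes s x (I - {p}) T (idx1 p z)\<bar> \<le> ?B z" for z
    proof (rule abs_contract_modes_le)
      show "finite (I - {p})"
        using assms(1) by simp
      show "\<bar>x j $ y\<bar> \<le> vec (s j) (\<lambda>_. 1) $ y" if "j \<in> I - {p}" "y < s j" for j y
      proof -
        have "x j \<in> carrier_vec (s j)" "vnorm (x j) = 1"
          using x that(1) by auto
        then show ?thesis
          using abs_vec_index_le_vnorm[of y "x j"] that(2) by auto
      qed
    qed
    have "r = L2_set (\<lambda>z. \<bar>contract_modes s x (I - {p}) T (idx1 p z)\<bar>) {..<s p}"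
      unfolding r_eq by (simp add: L2_set_def)
    also have "\<dots> \<le> L2_set ?B {..<s p}"
      using le by (intro L2_set_mono) auto
    finally show ?thesis .
  qed
  then have "bdd_above ?S"
    by (rule bdd_aboveI)
  moreover have "vnorm (vec (s p) (\<lambda>z. contract_modes s v (I - {p}) T (idx1 p z))) \<in> ?S"
    using v unfolding p_def by blast
  ultimately have "vnorm (vec (s p) (\<lambda>z. contract_modes s v (I - {p}) T (idx1 p z))) \<le> Sup ?S"
    by (rule cSup_upper[rotated])
  then show ?thesis
    by (simp add: spectral_norm_def vnorm_vec p_def Let_def)
qed

text \<open>Positive sizes provide the unit vector \<open>unit_vec (s l) 0\<close> in every mode, so
  the supremum is over a nonempty set of norms; the \<open>Sup\<close> of the empty set would say
  nothing about the sign.\<close>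

lemma spectral_norm_nonneg:
  assumes "finite I" "\<And>l. l \<in> I \<Longrightarrow> 0 < s l"
  shows "0 \<le> spectral_norm I s T"
proof -
  have "fibre_norm s (\<lambda>l. unit_vec (s l) 0) I (Min I) T \<le> spectral_norm I s T"
    using assms by (intro fibre_norm_unit_le_spectral_norm) (auto simp: vnorm_def)
  then show ?thesis
    by (rule order_trans[OF L2_set_nonneg])
qed

text \<open>By homogeneity: scaling every vector to unit length divides the fibre by the product of
  the norms. A zero vector cannot be scaled, but then both sides vanish.\<close>

lemma fibre_norm_Min_le:
  assumes "finite I" "\<And>j. j \<in> I - {Min I} \<Longrightarrow> v j \<in> carrier_vec (s j)"
  shows "fibre_norm s v I (Min I) T \<le> spectral_norm I s T * (\<Prod>j\<in>I - {Min I}. vnorm (v j))"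
proof (cases "\<exists>j\<in>I - {Min I}. vnorm (v j) = 0")
  case True
  then obtain j where j: "j \<in> I - {Min I}" "vnorm (v j) = 0"
    by blast
  then have v0: "v j $ y = 0" if "y < s j" for y
    using that assms(2)[OF j(1)] by (simp add: vnorm_eq_0_iff)
  \<comment> \<open>The trivial update \<open>v(j := v j)\<close> gives the term the shape of
    \<open>contract_modes_upd\<close>, which exposes the contraction with the zero vector.\<close>
  have "contract_modes s (v(j := v j)) (I - {Min I}) T i = 0" for i
    using assms(1) j(1) v0 by (subst contract_modes_upd) (auto simp: contract_def)
  moreover have "(\<Prod>j\<in>I - {Min I}. vnorm (v j)) = 0"
    using True assms(1) by simp
  ultimately show ?thesis
    by (simp add: L2_set_def)
next
  case False
  let ?J = "I - {Min I}"
  define u where "u = (\<lambda>j. (1 / vnorm (v j)) \<cdot>\<^sub>v v j)"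
  have pos: "0 < vnorm (v j)" if "j \<in> ?J" for j
    using False that vnorm_nonneg[of "v j"] by (metis less_eq_real_def)
  have u: "u j \<in> carrier_vec (s j) \<and> vnorm (u j) = 1" if "j \<in> ?J" for j
    using assms(2)[OF that] pos[OF that] by (simp add: u_def vnorm_smult)
  have P: "0 < (\<Prod>j\<in>?J. vnorm (v j))"
    using pos by (rule prod_pos)
  have "contract_modes s u ?J T i = contract_modes s v ?J T i / (\<Prod>j\<in>?J. vnorm (v j))" for i
    unfolding u_def using assms
    by (subst contract_modes_smult) (auto simp: prod_dividef)
  then have "fibre_norm s u I (Min I) T
      = fibre_norm s v I (Min I) T / (\<Prod>j\<in>?J. vnorm (v j))"
    using P by (simp add: L2_set_right_distrib divide_inverse mult.commute)
  moreover have "fibre_norm s u I (Min I) T \<le> spectral_norm I s T"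
    using assms(1) u by (rule fibre_norm_unit_le_spectral_norm)
  ultimately show ?thesis
    using P by (simp add: pos_divide_le_eq)
qed

text \<open>The choice of the free mode in \<open>spectral_norm\<close> is immaterial: contract the fibre of mode \<open>m\<close>
  with itself, and apply the Cauchy-Schwarz inequality in the mode \<open>Min I\<close> instead.\<close>

lemma fibre_norm_le:
  assumes "finite I" "m \<in> I" "\<And>l. l \<in> I \<Longrightarrow> 0 < s l"
    and v: "\<And>j. j \<in> I - {m} \<Longrightarrow> v j \<in> carrier_vec (s j)"
  shows "fibre_norm s v I m T \<le> spectral_norm I s T * (\<Prod>j\<in>I - {m}. vnorm (v j))"
proof (cases "m = Min I")
  case True
  then show ?thesis
    using fibre_norm_Min_le[OF assms(1), of v s T] v by simp
next
  case False
  define p where "p = Min I"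
  define J where "J = I - {m} - {p}"
  define E where "E = contract_modes s v J T"
  define F where "F = (\<lambda>z. contract_modes s v (I - {m}) T (idx1 m z))"
  \<comment> \<open>The fibre itself, not normalised, becomes the vector for mode \<open>m\<close>,
    and mode \<open>p\<close> becomes free in exchange.\<close>
  define u where "u = vec (s m) F"
  define G where "G = (\<lambda>y. contract_modes s (v(m := u)) (I - {p}) T (idx1 p y))"
  define Q where "Q = spectral_norm I s T * (\<Prod>j\<in>I - {m}. vnorm (v j))"
  have p: "p \<in> I" "p \<noteq> m"
    using assms(1,2) False Min_in[of I] unfolding p_def by blast+
  have J: "finite J" "I - {p} - {m} = J" "I - {m} = insert p J" "I - {p} = insert m J"
    "p \<notin> J" "m \<notin> J"
    using p assms(1,2) by (auto simp: J_def)
  have Q: "0 \<le> Q"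
    unfolding Q_def using assms
    by (intro mult_nonneg_nonneg spectral_norm_nonneg prod_nonneg) (auto simp: vnorm_nonneg)
  have F: "F z = (\<Sum>y<s p. E ((idx1 m z)(p := y)) * v p $ y)" for z
    unfolding F_def J(3) E_def using J by (simp add: contract_modes_insert contract_def)
  have "G y = (\<Sum>z<s m. E ((idx1 p y)(m := z)) * F z)" for y
    unfolding G_def E_def using J
    by (subst contract_modes_upd) (auto simp: contract_def u_def)
  then have G: "G y = (\<Sum>z<s m. E ((idx1 m z)(p := y)) * F z)" for y
    using p(2) by (simp add: idx1_def fun_upd_twist)
  \<comment> \<open>\<open>F\<close> and \<open>G\<close> are contractions of the same array
    \<open>E\<close>, so exchanging the sums turns the pairing of \<open>F\<close> with itself into
    the pairing of \<open>v p\<close> with \<open>G\<close>.\<close>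
  have "(L2_set F {..<s m})\<^sup>2 = (\<Sum>z<s m. (\<Sum>y<s p. E ((idx1 m z)(p := y)) * v p $ y) * F z)"
    by (simp add: L2_set_def sum_nonneg power2_eq_square flip: F)
  also have "\<dots> = (\<Sum>y<s p. v p $ y * G y)"
    unfolding G sum_distrib_left sum_distrib_right
    by (subst sum.swap) (simp add: mult_ac)
  also have "\<dots> \<le> (\<Sum>y<s p. \<bar>v p $ y\<bar> * \<bar>G y\<bar>)"
    by (intro sum_mono) (simp flip: abs_mult)
  also have "\<dots> \<le> L2_set (vec_index (v p)) {..<s p} * L2_set G {..<s p}"
    by (rule L2_set_mult_ineq)
  also have "L2_set (vec_index (v p)) {..<s p} = vnorm (v p)"
    using v[of p] p by (simp add: vnorm_L2_set)
  \<comment> \<open>Mode \<open>p\<close> is the minimal one, so the bound already known applies to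
    \<open>G\<close>; it brings in the factor \<open>vnorm u\<close>, which is the norm of
    \<open>F\<close> again.\<close>
  also have "vnorm (v p) * L2_set G {..<s p}
      \<le> vnorm (v p) * (spectral_norm I s T * (\<Prod>j\<in>I - {p}. vnorm ((v(m := u)) j)))"
    unfolding G_def p_def using assms(1) v
    by (intro mult_left_mono fibre_norm_Min_le) (auto simp: u_def vnorm_nonneg)
  also have "(\<Prod>j\<in>I - {p}. vnorm ((v(m := u)) j)) = vnorm u * (\<Prod>j\<in>J. vnorm ((v(m := u)) j))"
    unfolding J(4) using J by simp
  also have "(\<Prod>j\<in>J. vnorm ((v(m := u)) j)) = (\<Prod>j\<in>J. vnorm (v j))"
    using J by (intro prod.cong) auto
  also have "vnorm u = L2_set F {..<s m}"
    unfolding u_def by (rule vnorm_vec)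
  also have "vnorm (v p) * (spectral_norm I s T * (L2_set F {..<s m} * (\<Prod>j\<in>J. vnorm (v j))))
      = Q * L2_set F {..<s m}"
    unfolding Q_def J(3) using J by simp
  finally have "L2_set F {..<s m} * L2_set F {..<s m} \<le> Q * L2_set F {..<s m}"
    by (simp add: power2_eq_square)
  \<comment> \<open>One factor cancels; if the norm of \<open>F\<close> is zero, the claim is just
    \<open>0 \<le> Q\<close>.\<close>
  then have "L2_set F {..<s m} \<le> Q"
    using Q L2_set_nonneg[of F "{..<s m}"] by (cases "L2_set F {..<s m} = 0") auto
  then show ?thesis
    by (simp add: F_def Q_def)
qed

section \<open>Perturbing the columns one mode at a time\<close>

lemma contract_modes_perturbation:
  assumes I: "finite I" "m \<in> I" "\<And>l. l \<in> I \<Longrightarrow> 0 < s l"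
    and K: "K \<subseteq> I - {m}"
    and a: "\<And>j. j \<in> I - {m} \<Longrightarrow> a j \<in> carrier_vec (s j)"
    and d: "\<And>j. j \<in> I - {m} \<Longrightarrow> d j \<in> carrier_vec (s j)"
    and da: "\<And>j. j \<in> I - {m} \<Longrightarrow> vnorm (d j) \<le> \<epsilon> * vnorm (a j)"
    and "0 \<le> \<epsilon>"
  shows "L2_set (\<lambda>z. contract_modes s (\<lambda>j. if j \<in> K then a j - d j else a j) (I - {m}) T (idx1 m z)
            - contract_modes s a (I - {m}) T (idx1 m z)) {..<s m}
     \<le> ((1 + \<epsilon>) ^ card K - 1) * (spectral_norm I s T * (\<Prod>j\<in>I - {m}. vnorm (a j)))"
proof -
  let ?J = "I - {m}"
  let ?mix = "\<lambda>K j. if j \<in> K then a j - d j else a j"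
  let ?F = "\<lambda>v z. contract_modes s v ?J T (idx1 m z)"
  let ?P = "\<Prod>j\<in>?J. vnorm (a j)"
  let ?S = "spectral_norm I s T"
  have S: "0 \<le> ?S"
    using I(1,3) by (rule spectral_norm_nonneg)
  have "finite K"
    using K I(1) by (auto intro: finite_subset)
  then show ?thesis
    using K
  \<comment> \<open>\<open>K\<close> holds the modes already perturbed. Adding \<open>k\<close>
    changes the fibre by one that has \<open>d k\<close> in mode \<open>k\<close> and vectors of
    norm at most \<open>(1 + \<epsilon>) * vnorm (a j)\<close> in the modes of \<open>K\<close>. The
    relative costs \<open>\<epsilon> * (1 + \<epsilon>) ^ card K\<close> form a geometric
    sum.\<close>
  proof (induction K)
    case empty
    then show ?case by (simp add: L2_set_def)
  next
    case (insert k K)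
    have k: "k \<in> ?J" "k \<notin> K" and K: "K \<subseteq> ?J"
      using insert by auto
    define w where "w = (?mix K)(k := d k)"
    have mix_ins: "?mix (insert k K) = (?mix K)(k := a k - d k)"
      by auto
    \<comment> \<open>As \<open>k \<notin> K\<close>, the old hybrid is an update at
      \<open>k\<close> too, so linearity in mode \<open>k\<close> relates three hybrids that differ
      only there.\<close>
    have mix_K: "?mix K = (?mix K)(k := a k)"
      using k by auto
    have step: "?F (?mix (insert k K)) z = ?F (?mix K) z - ?F w z" for z
    proof -
      let ?C = "contract_modes s (?mix K) (?J - {k}) T"
      have upd: "?F ((?mix K)(k := u)) z = (\<Sum>y<s k. ?C ((idx1 m z)(k := y)) * u $ y)" for u
        using I(1) k(1) by (subst contract_modes_upd) (auto simp: contract_def)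
      have sub: "(a k - d k) $ y = a k $ y - d k $ y" if "y < s k" for y
        using that d[OF k(1)] by simp
      have "?F ((?mix K)(k := a k - d k)) z = ?F ((?mix K)(k := a k)) z - ?F w z"
        unfolding w_def upd by (simp add: sub right_diff_distrib sum_subtractf)
      then show ?thesis
        by (simp only: mix_ins flip: mix_K)
    qed
    have norm_mix: "vnorm (?mix K j) \<le> (if j \<in> K then 1 + \<epsilon> else 1) * vnorm (a j)"
      if "j \<in> ?J" for j
      using vnorm_triangle_diff[OF a[OF that] d[OF that]] da[OF that] by (auto simp: algebra_simps)
    have "L2_set (?F w) {..<s m} \<le> ?S * (\<Prod>j\<in>?J. vnorm (w j))"
      using I a d by (intro fibre_norm_le) (auto simp: w_def)
    also have "(\<Prod>j\<in>?J. vnorm (w j)) = vnorm (d k) * (\<Prod>j\<in>?J - {k}. vnorm (?mix K j))"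
      using I(1) k by (subst prod.remove[of _ k]) (auto simp: w_def intro!: prod.cong)
    also have "\<dots> \<le> (\<epsilon> * vnorm (a k))
        * (\<Prod>j\<in>?J - {k}. (if j \<in> K then 1 + \<epsilon> else 1) * vnorm (a j))"
      using da k norm_mix \<open>0 \<le> \<epsilon>\<close>
      by (intro mult_mono prod_mono prod_nonneg) (auto simp: vnorm_nonneg)
    also have "\<dots> = \<epsilon> * (1 + \<epsilon>) ^ card K * ?P"
    proof -
      \<comment> \<open>Factors outside \<open>K\<close> are 1, and \<open>k\<close> is not in
        \<open>K\<close>, so exactly \<open>card K\<close> factors \<open>1 + \<epsilon>\<close>
        remain.\<close>
      have "(\<Prod>j\<in>?J - {k}. if j \<in> K then 1 + \<epsilon> else 1) = (\<Prod>j\<in>K. 1 + \<epsilon>)"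
        using I(1) K k by (intro prod.mono_neutral_cong_right) auto
      moreover have "?P = vnorm (a k) * (\<Prod>j\<in>?J - {k}. vnorm (a j))"
        using I(1) k by (intro prod.remove) auto
      ultimately show ?thesis
        by (simp add: prod.distrib)
    qed
    finally have w: "L2_set (?F w) {..<s m} \<le> \<epsilon> * (1 + \<epsilon>) ^ card K * (?S * ?P)"
      using S by (simp add: mult_right_mono mult_ac)
    have "L2_set (\<lambda>z. ?F (?mix (insert k K)) z - ?F a z) {..<s m}
        = L2_set (\<lambda>z. (?F (?mix K) z - ?F a z) + - ?F w z) {..<s m}"
      unfolding step by (simp add: algebra_simps)
    also have "\<dots> \<le> L2_set (\<lambda>z. ?F (?mix K) z - ?F a z) {..<s m}
        + L2_set (\<lambda>z. - ?F w z) {..<s m}"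
      by (rule L2_set_triangle_ineq)
    also have "L2_set (\<lambda>z. - ?F w z) {..<s m} = L2_set (?F w) {..<s m}"
      by (simp add: L2_set_def)
    also have "L2_set (\<lambda>z. ?F (?mix K) z - ?F a z) {..<s m} + L2_set (?F w) {..<s m}
        \<le> ((1 + \<epsilon>) ^ card K - 1) * (?S * ?P) + \<epsilon> * (1 + \<epsilon>) ^ card K * (?S * ?P)"
      using insert.IH[OF K] w by (rule add_mono)
    \<comment> \<open>With \<open>q = 1 + \<epsilon>\<close> and \<open>r = card K\<close> this is
      \<open>(q ^ r - 1) + \<epsilon> * q ^ r = q ^ Suc r - 1\<close>.\<close>
    also have "\<dots> = ((1 + \<epsilon>) ^ card (insert k K) - 1) * (?S * ?P)"
      using insert.hyps by (simp add: algebra_simps)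
    finally show ?case .
  qed
qed

text \<open>With \<open>x = real N * \<epsilon>\<close> in the unit interval, \<open>exp x\<close>
  is at most \<open>1 + x + x^2\<close>, and \<open>x^2 \<le> x\<close> gives the factor 2. In the
  application \<open>r\<close> is the number of perturbed modes.\<close>

lemma power_one_plus_minus_one_le:
  fixes \<epsilon> :: real
  assumes "0 \<le> \<epsilon>" "r \<le> N" "real N * \<epsilon> \<le> 1"
  shows "(1 + \<epsilon>) ^ r - 1 \<le> 2 * (real N * \<epsilon>)"
proof -
  have "(1 + \<epsilon>) ^ r \<le> (1 + \<epsilon>) ^ N"
    using assms by (intro power_increasing) auto
  also have "\<dots> \<le> exp \<epsilon> ^ N"
    using assms by (intro power_mono exp_ge_add_one_self) auto
  also have "\<dots> = exp (real N * \<epsilon>)"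
    by (rule exp_of_nat_mult[symmetric])
  also have "\<dots> \<le> 1 + real N * \<epsilon> + (real N * \<epsilon>)\<^sup>2"
    using assms by (intro exp_bound) auto
  also have "(real N * \<epsilon>)\<^sup>2 \<le> real N * \<epsilon>"
    using assms by (simp add: power2_eq_square mult_left_le)
  finally show ?thesis by linarith
qed

section \<open>The update as a fibre, and its error\<close>

lemma col_mttkrp_update:
  assumes "k < R" "n < N" "m \<noteq> n" "D \<in> carrier_mat (s n) R"
  shows "col (mttkrp_update N s R X A m n D) k
     = vec (s m) (\<lambda>x. contract_modes s (\<lambda>j. col (A j) k) ({..<N} - {n} - {m})
         (contract s n (col D k) X) (idx1 m x))"
proof (rule eq_vecI)
  fix x assume x: "x < dim_vec (vec (s m) (\<lambda>x. contract_modes s (\<lambda>j. col (A j) k)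
    ({..<N} - {n} - {m}) (contract s n (col D k) X) (idx1 m x)))"
  have J: "{..<N} - {n} - {m} = {..<N} - {m, n}"
    by auto
  \<comment> \<open>The update contracts with the change of factor \<open>n\<close> last, the tensor
    in the bound contracts with it first. Commuting the two makes the update a fibre of a tensor
    with modes \<open>{..<N} - {n}\<close>.\<close>
  have "contract_modes s (\<lambda>j. col (A j) k) ({..<N} - {m, n}) (contract s n (col D k) X)
      = contract s n (col D k) (contract_modes s (\<lambda>j. col (A j) k) ({..<N} - {m, n}) X)"
    by (subst contract_contract_modes) auto
  then show "col (mttkrp_update N s R X A m n D) k $ x
      = vec (s m) (\<lambda>x. contract_modes s (\<lambda>j. col (A j) k) ({..<N} - {n} - {m})
          (contract s n (col D k) X) (idx1 m x)) $ x"
    using x assms unfolding J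
    by (simp add: mttkrp_update_def pair_op_def contract_def idx1_def idx2_def)
qed (simp add: mttkrp_update_def)

text \<open>Here \<open>contract_modes_perturbation\<close> is applied with the modes other than
  \<open>n\<close> and with \<open>K\<close> all of them except \<open>m\<close>. The current
  columns are the base point because \<open>\<epsilon>\<close> is measured relative to them; the
  columns of \<open>Ap\<close> are then the perturbed ones.\<close>

lemma mttkrp_update_error:
  fixes \<epsilon> :: real
  assumes s: "\<forall>l<N. 0 < s l"
    and A: "\<forall>l<N. Ap l \<in> carrier_mat (s l) R \<and> dA l \<in> carrier_mat (s l) R \<and> A l = Ap l + dA l"
    and D: "D \<in> carrier_mat (s n) R"
    and k: "k < R"
    and eps: "\<forall>l<N. vnorm (col (dA l) k) \<le> \<epsilon> * vnorm (col (A l) k)" "0 \<le> \<epsilon>" "real N * \<epsilon> \<le> 1"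
    and mn: "m < N" "n < N" "m \<noteq> n"
  shows "vnorm (col (mttkrp_update N s R X Ap m n D) k - col (mttkrp_update N s R X A m n D) k)
     \<le> 2 * (real N * \<epsilon>) * spectral_norm ({..<N} - {n}) s (contract s n (col D k) X)
        * (\<Prod>j\<in>{..<N} - {m, n}. vnorm (col (A j) k))"
proof -
  let ?I = "{..<N} - {n}"
  let ?J = "?I - {m}"
  let ?a = "\<lambda>j. col (A j) k"
  let ?d = "\<lambda>j. col (dA j) k"
  let ?T = "contract s n (col D k) X"
  let ?Q = "spectral_norm ?I s ?T * (\<Prod>j\<in>?J. vnorm (?a j))"
  let ?F = "\<lambda>v z. contract_modes s v ?J ?T (idx1 m z)"
  have carrier: "?a j \<in> carrier_vec (s j)" "?d j \<in> carrier_vec (s j)" if "j < N" for j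
  proof -
    have "Ap j \<in> carrier_mat (s j) R" "dA j \<in> carrier_mat (s j) R" "A j = Ap j + dA j"
      using A that by auto
    then show "?a j \<in> carrier_vec (s j)" "?d j \<in> carrier_vec (s j)"
      by (auto intro!: carrier_vecI)
  qed
  \<comment> \<open>A contraction in mode \<open>j\<close> reads only the entries below
    \<open>s j\<close>, so agreement there suffices to exchange the two descriptions of the
    perturbed columns.\<close>
  have Ap: "(?a j - ?d j) $ y = col (Ap j) k $ y" if "j < N" "y < s j" for j y
    using A that k by fastforce
  have mix: "?F (\<lambda>j. col (Ap j) k) z = ?F (\<lambda>j. if j \<in> ?J then ?a j - ?d j else ?a j) z" for z
    using Ap by (subst contract_modes_cong) auto
  have Q: "0 \<le> ?Q"
    using s by (intro mult_nonneg_nonneg spectral_norm_nonneg prod_nonneg) (auto simp: vnorm_nonneg)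
  have "card ?J \<le> card {..<N}"
    by (intro card_mono) auto
  then have card: "card ?J \<le> N"
    by simp
  have "vnorm (col (mttkrp_update N s R X Ap m n D) k - col (mttkrp_update N s R X A m n D) k)
      = vnorm (vec (s m) (\<lambda>z. ?F (\<lambda>j. col (Ap j) k) z - ?F ?a z))"
    using k mn D by (simp add: col_mttkrp_update) (intro arg_cong[of _ _ vnorm] eq_vecI; simp)
  also have "\<dots> = L2_set (\<lambda>z. ?F (\<lambda>j. if j \<in> ?J then ?a j - ?d j else ?a j) z - ?F ?a z) {..<s m}"
    unfolding vnorm_vec by (simp only: mix)
  also have "\<dots> \<le> ((1 + \<epsilon>) ^ card ?J - 1) * ?Q"
    using s mn eps carrier by (intro contract_modes_perturbation) auto
  also have "\<dots> \<le> 2 * (real N * \<epsilon>) * ?Q"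
    using eps card Q by (intro mult_right_mono power_one_plus_minus_one_le) auto
  also have "?J = {..<N} - {m, n}"
    by auto
  finally show ?thesis
    by (simp add: mult.assoc)
qed

theorem theorem4p1:
  shows "\<exists>C c :: real. 0 < C \<and> 0 < c \<and>
    (\<forall>(N :: nat) (s :: nat \<Rightarrow> nat) (R :: nat) (X :: tensor)
       (A :: nat \<Rightarrow> real mat) (Ap :: nat \<Rightarrow> real mat) (dA :: nat \<Rightarrow> real mat)
       (\<delta>A :: nat \<Rightarrow> real mat) (k :: nat) (\<epsilon> :: real).
      (\<forall>l<N. 0 < s l) \<longrightarrow>
      (\<forall>l<N. Ap l \<in> carrier_mat (s l) R \<and> dA l \<in> carrier_mat (s l) R \<and> A l = Ap l + dA l) \<longrightarrow>
      (\<forall>n<N. \<delta>A n = als_update N s R X A n - A n) \<longrightarrow>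
      k < R \<longrightarrow>
      (\<forall>l<N. vnorm (col (A l) k) \<noteq> 0 \<and> vnorm (col (dA l) k) / vnorm (col (A l) k) \<le> \<epsilon>) \<longrightarrow>
      \<epsilon> < 1 \<longrightarrow>
      real N * \<epsilon> \<le> c \<longrightarrow>
      (\<forall>m<N. \<forall>n<N. m \<noteq> n \<longrightarrow>
         vnorm (col (mttkrp_update N s R X Ap m n (\<delta>A n)) k
                - col (mttkrp_update N s R X A m n (\<delta>A n)) k)
         \<le> C * (real N * \<epsilon>)
            * spectral_norm ({..<N} - {n}) s (contract s n (col (\<delta>A n) k) X)
            * (\<Prod>j\<in>{..<N} - {m, n}. vnorm (col (A j) k))))"
\<comment> \<open>Both witnesses come from \<open>power_one_plus_minus_one_le\<close>: its factor 2
  and its condition \<open>real N * \<epsilon> \<le> 1\<close>.\<close>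
proof (rule exI[of _ 2], rule exI[of _ 1], intro conjI allI impI)
  fix N s R X A Ap dA and \<delta>A :: "nat \<Rightarrow> real mat" and k :: nat and \<epsilon> :: real and m n
  assume s: "\<forall>l<N. 0 < s l"
    and A: "\<forall>l<N. Ap l \<in> carrier_mat (s l) R \<and> dA l \<in> carrier_mat (s l) R \<and> A l = Ap l + dA l"
    and \<delta>A: "\<forall>n<N. \<delta>A n = als_update N s R X A n - A n"
    and k: "k < R"
    and eps: "\<forall>l<N. vnorm (col (A l) k) \<noteq> 0 \<and> vnorm (col (dA l) k) / vnorm (col (A l) k) \<le> \<epsilon>"
    and small: "real N * \<epsilon> \<le> 1"
    and mn: "m < N" "n < N" "m \<noteq> n"
  have "vnorm (col (dA l) k) \<le> \<epsilon> * vnorm (col (A l) k)" if "l < N" for l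
  proof -
    have "0 < vnorm (col (A l) k)"
      using eps that vnorm_nonneg[of "col (A l) k"] by (simp add: less_le)
    then show ?thesis
      using eps[rule_format, OF that] by (simp add: pos_divide_le_eq)
  qed
  \<comment> \<open>Mode \<open>m\<close> exists, so \<open>\<epsilon>\<close> lies above at least
    one quotient of norms.\<close>
  moreover have "0 \<le> \<epsilon>"
    using eps mn(1) vnorm_nonneg by (meson divide_nonneg_nonneg order_trans)
  \<comment> \<open>A matrix difference takes its dimensions from the second operand, here
    \<open>A n\<close>, and a sum likewise, here from \<open>dA n\<close>.\<close>
  moreover have "\<delta>A n \<in> carrier_mat (s n) R"
    using \<delta>A A mn(2) by (metis add_carrier_mat minus_carrier_mat)
  ultimately show "vnorm (col (mttkrp_update N s R X Ap m n (\<delta>A n)) k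
                - col (mttkrp_update N s R X A m n (\<delta>A n)) k)
         \<le> 2 * (real N * \<epsilon>)
            * spectral_norm ({..<N} - {n}) s (contract s n (col (\<delta>A n) k) X)
            * (\<Prod>j\<in>{..<N} - {m, n}. vnorm (col (A j) k))"
    using mttkrp_update_error[OF s A] k small mn by blast
qed simp_all

end
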